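(* Let $n,m\ge2$ be integers and let $a_1,\dots,a_{n+m}$ be real numbers with $0\le a_i\le1$ for all $i$ and $a_n+a_{n+m}\le1$. Put $\bar a_i=1-a_i$ for $i\neq n,n+m$ and $\bar a_n=\bar a_{n+m}=1-a_n-a_{n+m}$. Let $(q^k)_{k\in\mathbb N}$ be the trajectory of the junction dynamics (defined in the context) starting from $q^0=0$. Then the distances between any pair of states stay bounded: there exists $c_1$ such that $$\sup_k|q_i^k-q_j^k|\le c_1\quad\text{for all } i,j\in\{1,\dots,n+m\}.$$ Moreover, for every integer $T\ge1$ there exists $c_2$ such that $$\sup_k|q_i^{k+T}-q_i^k|\le c_2T\quad\text{for all } i\in\{1,\dots,n+m\}.$$
   Context: All formulas are in ordinary arithmetic. The junction dynamics (traffic on two circular roads crossing at one junction) is the recursion on $q^k=(q^k_1,\dots,q^k_{n+m})\in\mathbb R^{n+m}$, $k\in\mathbb N$, given by $$\begin{cases} q_i^{k+1}=\min\{a_{i-1}+q_{i-1}^k,\ \bar a_i+q_{i+1}^k\}, & i\in\{1,\dots,n+m\}\setminus\{1,n,n+1,n+m\},\\ q_n^{k+1}=\min\{\bar a_n+q_1^k+q_{n+1}^k-q_{n+m}^k,\ a_{n-1}+q_{n-1}^k\},\\ q_{n+m}^{k+1}=\min\{\bar a_{n+m}+q_1^k+q_{n+1}^k-q_n^{k+1},\ a_{n+m-1}+q_{n+m-1}^k\},\\ q_1^{k+1}=\min\{a_n+\tfrac12(q_n^k+q_{n+m}^k),\ \bar a_1+q_2^k\},\\ q_{n+1}^{k+1}=\min\{a_{n+m}+\tfrac12(q_n^k+q_{n+m}^k),\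 \bar a_{n+1}+q_{n+2}^k\}. \end{cases}$$ (The third line uses $q_n^{k+1}$, which is determined by the second line.) *)

theory Defs
  imports Complex_Main "HOL-Library.Extended_Real"
begin

definition abar :: "nat \<Rightarrow> nat \<Rightarrow> (nat \<Rightarrow> real) \<Rightarrow> nat \<Rightarrow> real" where
  "abar n m a i = (if i = n \<or> i = n + m then 1 - a n - a (n + m) else 1 - a i)"

(* Only the coordinates 1, ..., n + m are meaningful; all others stay unconstrained.
   The update of coordinate n + m uses the already updated coordinate n. *)
definition junction_dynamics :: "nat \<Rightarrow> nat \<Rightarrow> (nat \<Rightarrow> real) \<Rightarrow> (nat \<Rightarrow> nat \<Rightarrow> real) \<Rightarrow> bool" where
  "junction_dynamics n m a q \<longleftrightarrow>
    (\<forall>k.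
      (\<forall>i \<in> {1..n+m} - {1, n, n + 1, n + m}.
        q (Suc k) i = min (a (i - 1) + q k (i - 1)) (abar n m a i + q k (i + 1))) \<and>
      q (Suc k) n =
        min (abar n m a n + q k 1 + q k (n + 1) - q k (n + m)) (a (n - 1) + q k (n - 1)) \<and>
      q (Suc k) (n + m) =
        min (abar n m a (n + m) + q k 1 + q k (n + 1) - q (Suc k) n)
            (a (n + m - 1) + q k (n + m - 1)) \<and>
      q (Suc k) 1 =
        min (a n + (q k n + q k (n + m)) / 2) (abar n m a 1 + q k 2) \<and>
      q (Suc k) (n + 1) =
        min (a (n + m) + (q k n + q k (n + m)) / 2) (abar n m a (n + 1) + q k (n + 2)))"

end

theory Submission
  imports Defs
begin

text \<open>
  Read \<open>q k i\<close> as the cumulated flow into cell \<open>i\<close>. Then \<open>a i + q k i - q k (i + 1)\<close> is the occupation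
  of an ordinary cell \<open>i\<close>, while \<open>n\<close> and \<open>n + m\<close> together form the junction cell. The dynamics keeps
  every occupation in \<open>[0, 1]\<close>, because the flow out of a cell never exceeds its content and the flow
  into it never exceeds its free space. Bounded occupations mean bounded differences between
  neighbours, and each coordinate grows by at most 1 per step.
\<close>

text \<open>The junction content is the sum of the parts bound for the two exits; the second and third
  conjuncts keep each part nonnegative separately.\<close>

definition admissible :: "nat \<Rightarrow> nat \<Rightarrow> (nat \<Rightarrow> real) \<Rightarrow> (nat \<Rightarrow> real) \<Rightarrow> bool" where
  "admissible n m a p \<longleftrightarrow>
    (\<forall>i \<in> {1..n+m} - {n, n + m}. 0 \<le> a i + p i - p (i + 1) \<and> a i + p i - p (i + 1) \<le> 1) \<and>
    p 1 \<le> a n + (p n + p (n + m)) / 2 \<and>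
    p (n + 1) \<le> a (n + m) + (p n + p (n + m)) / 2 \<and>
    a n + a (n + m) + p n + p (n + m) - p 1 - p (n + 1) \<le> 1"

lemma admissible_cell:
  assumes "admissible n m a p" "1 \<le> i" "i < n + m" "i \<noteq> n"
  shows "0 \<le> a i + p i - p (i + 1)" "a i + p i - p (i + 1) \<le> 1"
  using assms by (auto simp: admissible_def)

lemma admissible_junction:
  assumes "admissible n m a p"
  shows "p 1 \<le> a n + (p n + p (n + m)) / 2"
    and "p (n + 1) \<le> a (n + m) + (p n + p (n + m)) / 2"
    and "a n + a (n + m) + p n + p (n + m) - p 1 - p (n + 1) \<le> 1"
  using assms by (auto simp: admissible_def)

lemma dynamics_junction:
  assumes "junction_dynamics n m a q"
  shows "q (Suc k) n =
        min (1 - a n - a (n + m) + q k 1 + q k (n + 1) - q k (n + m)) (a (n - 1) + q k (n - 1))"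
    and "q (Suc k) (n + m) =
        min (1 - a n - a (n + m) + q k 1 + q k (n + 1) - q (Suc k) n)
            (a (n + m - 1) + q k (n + m - 1))"
  using assms by (auto simp: junction_dynamics_def abar_def)

lemma dynamics_exits:
  assumes "n \<ge> 2" "m \<ge> 2" "junction_dynamics n m a q"
  shows "q (Suc k) 1 = min (a n + (q k n + q k (n + m)) / 2) (1 - a 1 + q k 2)"
    and "q (Suc k) (n + 1) =
        min (a (n + m) + (q k n + q k (n + m)) / 2) (1 - a (n + 1) + q k (n + 2))"
  using assms by (auto simp: junction_dynamics_def abar_def)

lemma dynamics_interior:
  assumes "junction_dynamics n m a q" "i \<in> {1..n+m} - {1, n, n + 1, n + m}"
  shows "q (Suc k) i = min (a (i - 1) + q k (i - 1)) (1 - a i + q k (i + 1))"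
  using assms by (auto simp: junction_dynamics_def abar_def)

text \<open>Relative to \<open>q k i\<close>, the right-hand side is the free space of cell
  \<open>i\<close>. The coordinates \<open>n\<close> and \<open>n + m\<close> are excluded because
  they compete for the same junction space.\<close>

lemma increment_le_free_space:
  assumes "n \<ge> 2" "m \<ge> 2" "junction_dynamics n m a q"
    and "1 \<le> i" "i < n + m" "i \<noteq> n"
  shows "q (Suc k) i \<le> 1 - a i + q k (i + 1)"
proof -
  consider "i = 1" | "i = n + 1" | "i \<in> {1..n+m} - {1, n, n + 1, n + m}"
    using assms(4-6) by auto
  then show ?thesis
  proof cases
    case 1
    then show ?thesis using dynamics_exits(1)[OF assms(1-3), of k] by (simp add: numeral_2_eq_2)
  next
    case 2
    then show ?thesis using dynamics_exits(2)[OF assms(1-3), of k] by simp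
  next
    case 3
    then show ?thesis using dynamics_interior[OF assms(3) 3, of k] by linarith
  qed
qed

lemma increment_le_supply:
  assumes "n \<ge> 2" "m \<ge> 2" "junction_dynamics n m a q"
    and "1 \<le> i" "i < n + m" "i \<noteq> n"
  shows "q (Suc k) (i + 1) \<le> a i + q k i"
proof -
  consider "i + 1 = n" | "i + 1 = n + m" | "i + 1 \<in> {1..n+m} - {1, n, n + 1, n + m}"
    using assms(4-6) by auto
  then show ?thesis
  proof cases
    case 1
    then show ?thesis using dynamics_junction(1)[OF assms(3), of k] by auto
  next
    case 2
    then have "n + m - 1 = i" by simp
    then show ?thesis using dynamics_junction(2)[OF assms(3), of k] 2 by simp
  next
    case 3
    then show ?thesis using dynamics_interior[OF assms(3) 3, of k] by auto
  qed
qed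

text \<open>Admissibility makes upstream content and downstream free space nonnegative, so neither
  argument of a minimum lies below the old value.\<close>

lemma increment_nonneg:
  assumes "n \<ge> 2" "m \<ge> 2" "junction_dynamics n m a q" "admissible n m a (q k)"
    and "1 \<le> i" "i \<le> n + m"
  shows "q k i \<le> q (Suc k) i"
proof -
  note cell = admissible_cell[OF assms(4)] and junction = admissible_junction[OF assms(4)]
  have n: "q k n \<le> q (Suc k) n"
    using dynamics_junction(1)[OF assms(3), of k] junction(3) cell(1)[of "n - 1"] assms(1,2)
    by auto
  consider "i = 1" | "i = n" | "i = n + 1" | "i = n + m" | "i \<in> {1..n+m} - {1, n, n + 1, n + m}"
    using assms(5,6) by auto
  then show ?thesis
  proof cases
    case 1
    then show ?thesis
      using dynamics_exits(1)[OF assms(1-3), of k] junction(1) cell(2)[of 1] assms(1,2)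
      by (auto simp: numeral_2_eq_2)
  next
    case 2
    then show ?thesis using n by simp
  next
    case 3
    then show ?thesis
      using dynamics_exits(2)[OF assms(1-3), of k] junction(2) cell(2)[of "n + 1"] assms(1,2)
      by auto
  next
    case 4
    have "0 \<le> a (n + m - 1) + q k (n + m - 1) - q k (n + m)"
      using cell(1)[of "n + m - 1"] assms(1,2) by simp
    \<comment> \<open>The update of \<open>n\<close> reserves room: \<open>q (Suc k) n\<close> is at
      most its first argument, which subtracts \<open>q k (n + m)\<close>, so what is left for
      \<open>n + m\<close> is at least \<open>q k (n + m)\<close>.\<close>
    then show ?thesis unfolding 4 using dynamics_junction[OF assms(3), of k] by linarith
  next
    case 5
    then show ?thesis
      using dynamics_interior[OF assms(3) 5, of k] cell(2)[of i] cell(1)[of "i - 1"]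
      \<comment> \<open>The case \<open>i - 1 = n\<close> is void since \<open>i\<close> is not
        \<open>n + 1\<close>; otherwise cell \<open>i - 1\<close> is an ordinary one.\<close>
      by (cases "i - 1 = n") auto
  qed
qed

lemma increment_le_1:
  assumes "n \<ge> 2" "m \<ge> 2" "junction_dynamics n m a q" "admissible n m a (q k)"
    and "1 \<le> i" "i \<le> n + m"
  shows "q (Suc k) i \<le> q k i + 1"
proof -
  \<comment> \<open>Since \<open>n + m\<close> is updated after \<open>n\<close>, the two inflows
    together fit into the junction. Its content is nonnegative, so they add up to at most 1, and
    neither is negative.\<close>
  have "q (Suc k) n + q (Suc k) (n + m) \<le> 1 - a n - a (n + m) + q k 1 + q k (n + 1)"
    using dynamics_junction(2)[OF assms(3), of k] by linarith
  moreover have "q k n \<le> q (Suc k) n" "q k (n + m) \<le> q (Suc k) (n + m)"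
    using increment_nonneg[OF assms(1-4)] assms(1,2) by auto
  moreover note admissible_junction(1,2)[OF assms(4)]
  ultimately have "q (Suc k) n \<le> q k n + 1" "q (Suc k) (n + m) \<le> q k (n + m) + 1"
    by argo+
  moreover have "q (Suc k) i \<le> 1 - a i + q k (i + 1)" "0 \<le> a i + q k i - q k (i + 1)"
    if "i \<noteq> n" "i \<noteq> n + m"
    using increment_le_free_space[OF assms(1-3), of i k] admissible_cell(1)[OF assms(4), of i]
      assms(5,6) that by auto
  ultimately show ?thesis by fastforce
qed

text \<open>Each flow is limited by content and free space before the step. By monotonicity,
  simultaneous inflow only adds content and simultaneous outflow only frees space, so every bound
  survives.\<close>

lemma admissible_Suc:
  assumes "n \<ge> 2" "m \<ge> 2" "junction_dynamics n m a q" "admissible n m a (q k)"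
  shows "admissible n m a (q (Suc k))"
proof -
  note mono = increment_nonneg[OF assms]
  have "0 \<le> a i + q (Suc k) i - q (Suc k) (i + 1) \<and> a i + q (Suc k) i - q (Suc k) (i + 1) \<le> 1"
    if "i \<in> {1..n+m} - {n, n + m}" for i
    using increment_le_free_space[OF assms(1-3), of i k] increment_le_supply[OF assms(1-3), of i k]
      mono[of i] mono[of "i + 1"] that by auto
  moreover have "q k n \<le> q (Suc k) n" "q k (n + m) \<le> q (Suc k) (n + m)"
    "q k 1 \<le> q (Suc k) 1" "q k (n + 1) \<le> q (Suc k) (n + 1)"
    using mono assms(1,2) by auto
  moreover have "q (Suc k) n + q (Suc k) (n + m) \<le> 1 - a n - a (n + m) + q k 1 + q k (n + 1)"
    using dynamics_junction(2)[OF assms(3), of k] by linarith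
  moreover have "q (Suc k) 1 \<le> a n + (q k n + q k (n + m)) / 2"
    "q (Suc k) (n + 1) \<le> a (n + m) + (q k n + q k (n + m)) / 2"
    using dynamics_exits[OF assms(1-3), of k] by auto
  ultimately show ?thesis unfolding admissible_def by (intro conjI ballI) (blast | argo)+
qed

lemma admissible_trajectory:
  assumes "n \<ge> 2" "m \<ge> 2" "\<forall>i \<in> {1..n+m}. 0 \<le> a i \<and> a i \<le> 1" "a n + a (n + m) \<le> 1"
    and "junction_dynamics n m a q" "\<forall>i \<in> {1..n+m}. q 0 i = 0"
  shows "admissible n m a (q k)"
proof (induction k)
  case 0
  \<comment> \<open>At time 0 the occupations are the densities \<open>a i\<close> themselves, and
    \<open>a n + a (n + m)\<close> for the junction.\<close>
  show ?case using assms(1-4,6) by (auto simp: admissible_def)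
next
  case (Suc k)
  then show ?case using admissible_Suc assms by blast
qed

text \<open>Telescoping, used both in space along a road and in time along the trajectory.\<close>

lemma abs_diff_le_of_unit_steps:
  fixes p :: "nat \<Rightarrow> real"
  assumes "i \<le> j" "\<And>l. i \<le> l \<Longrightarrow> l < j \<Longrightarrow> \<bar>p l - p (l + 1)\<bar> \<le> 1"
  shows "\<bar>p j - p i\<bar> \<le> real (j - i)"
  using assms
proof (induction rule: dec_induct)
  case (step j)
  then have "\<bar>p j - p i\<bar> \<le> real (j - i)" by simp
  moreover have "\<bar>p j - p (Suc j)\<bar> \<le> 1" using step by auto
  ultimately show ?case using step(1) by (simp add: of_nat_diff)
qed simp

lemma admissible_bounded_diff:
  assumes "n \<ge> 2" "m \<ge> 2" "\<forall>i \<in> {1..n+m}. 0 \<le> a i \<and> a i \<le> 1"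
    and "admissible n m a p" "i \<in> {1..n+m}" "j \<in> {1..n+m}"
  shows "\<bar>p i - p j\<bar> \<le> 2 * real (n + m) + 2"
proof -
  have unit: "\<bar>p l - p (l + 1)\<bar> \<le> 1" if "1 \<le> l" "l < n + m" "l \<noteq> n" for l
  proof -
    have "0 \<le> a l" "a l \<le> 1" using assms(3) that by auto
    then show ?thesis using admissible_cell[OF assms(4) that] by linarith
  qed
  \<comment> \<open>The path from \<open>entry l\<close> to \<open>l\<close> stays on one road and
    so never needs \<open>unit\<close> at the excluded index \<open>n\<close>.\<close>
  define entry where "entry l = (if l \<le> n then 1 else n + 1)" for l
  have road: "\<bar>p l - p (entry l)\<bar> \<le> real (n + m)" if "l \<in> {1..n+m}" for l
  proof -
    have "\<bar>p l - p (entry l)\<bar> \<le> real (l - entry l)"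
      using that by (intro abs_diff_le_of_unit_steps unit) (auto simp: entry_def split: if_splits)
    also have "\<dots> \<le> real (n + m)" using that by (intro of_nat_mono) auto
    finally show ?thesis .
  qed
  have "0 \<le> a n" "a n \<le> 1" "0 \<le> a (n + m)" "a (n + m) \<le> 1" using assms(1-3) by auto
  \<comment> \<open>With \<open>s = (p n + p (n + m)) / 2\<close>, the junction bounds put
    \<open>p 1\<close> in \<open>[a n + s - 1, a n + s]\<close> and \<open>p (n + 1)\<close> in
    \<open>[a (n + m) + s - 1, a (n + m) + s]\<close>; the two densities differ by at most
    1.\<close>
  then have "\<bar>p 1 - p (n + 1)\<bar> \<le> 2" using admissible_junction[OF assms(4)] by argo
  then have "\<bar>p (entry i) - p (entry j)\<bar> \<le> 2" by (auto simp: entry_def)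
  \<comment> \<open>One road for \<open>i\<close>, one for \<open>j\<close>, each crudely bounded by
    \<open>n + m\<close>, plus 2 between the entries.\<close>
  then show ?thesis using road[OF assms(5)] road[OF assms(6)] by argo
qed

theorem theorem6:
  fixes n m :: nat and a :: "nat \<Rightarrow> real" and q :: "nat \<Rightarrow> nat \<Rightarrow> real"
  assumes "n \<ge> 2" and "m \<ge> 2"
    and "\<forall>i \<in> {1..n+m}. 0 \<le> a i \<and> a i \<le> 1"
    and "a n + a (n + m) \<le> 1"
    and "junction_dynamics n m a q"
    and "\<forall>i \<in> {1..n+m}. q 0 i = 0"
  shows "(\<exists>c1::real. \<forall>i \<in> {1..n+m}. \<forall>j \<in> {1..n+m}.
            (SUP k. ereal \<bar>q k i - q k j\<bar>) \<le> ereal c1) \<and>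
         (\<forall>T::nat. T \<ge> 1 \<longrightarrow> (\<exists>c2::real. \<forall>i \<in> {1..n+m}.
            (SUP k. ereal \<bar>q (k + T) i - q k i\<bar>) \<le> ereal (c2 * real T)))"
proof (intro conjI allI impI)
  note adm = admissible_trajectory[OF assms]
  show "\<exists>c1::real. \<forall>i \<in> {1..n+m}. \<forall>j \<in> {1..n+m}. (SUP k. ereal \<bar>q k i - q k j\<bar>) \<le> ereal c1"
    using admissible_bounded_diff[OF assms(1-3) adm]
    by (intro exI[of _ "2 * real (n + m) + 2"] ballI SUP_least) auto
  fix T :: nat
  have "\<bar>q (k + T) i - q k i\<bar> \<le> real T" if "i \<in> {1..n+m}" for k i
  proof -
    have "\<bar>q l i - q (l + 1) i\<bar> \<le> 1" for l
      using increment_nonneg[OF assms(1,2,5) adm, of i l]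
        increment_le_1[OF assms(1,2,5) adm, of i l] that by auto
    then show ?thesis using abs_diff_le_of_unit_steps[of k "k + T" "\<lambda>l. q l i"] by simp
  qed
  then show "\<exists>c2::real. \<forall>i \<in> {1..n+m}. (SUP k. ereal \<bar>q (k + T) i - q k i\<bar>) \<le> ereal (c2 * real T)"
    \<comment> \<open>Each time step moves a coordinate by at most 1, so \<open>c2 = 1\<close>
      serves every \<open>T\<close>.\<close>
    by (intro exI[of _ 1] ballI SUP_least) auto
qed

end
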